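(* For every integer $n\ge 5$, the wheel $W_n=K_1\vee C_{n-1}$ of order $n$ satisfies $\operatorname{st}_{\gamma_{st}}(W_n)=1$.
   Context: All graphs are finite, simple and undirected. For a graph $G=(V,E)$, a set $D\subseteq V$ is a strong dominating set if every vertex $v\in V\setminus D$ is adjacent to some $u\in D$ with $\deg(v)\le\deg(u)$ (degrees taken in $G$). The strong domination number $\gamma_{st}(G)$ is the minimum size of a strong dominating set. For $S\subseteq V$, $G-S$ is the graph obtained by deleting the vertices of $S$. The stability of the strong domination number is $\operatorname{st}_{\gamma_{st}}(G)=\min\{|S| : S\subseteq V,\ \gamma_{st}(G-S)\ne\gamma_{st}(G)\}$. The join $G\vee H$ of disjoint graphs is obtained from $G\cup H$ by adding all edges between $V(G)$ and $V(H)$; $C_{m}$ is the cycle on $m$ vertices. *)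

theory Defs
  imports "Graph_Theory.Graph_Theory"
begin

text \<open>
  A finite simple undirected graph is a \<^locale>\<open>graph\<close> of the library: a finite,
  loop-free digraph without parallel arcs whose arc relation is symmetric. Each
  undirected edge is a pair of opposite arcs, so the degree of a vertex is its
  \<^const>\<open>out_degree\<close>.
\<close>

definition strong_dominating_set :: "('a, 'b) pre_digraph \<Rightarrow> 'a set \<Rightarrow> bool" where
  "strong_dominating_set G D \<longleftrightarrow>
     D \<subseteq> verts G \<and>
     (\<forall>v \<in> verts G - D. \<exists>u \<in> D. v \<rightarrow>\<^bsub>G\<^esub> u \<and> out_degree G v \<le> out_degree G u)"

definition strong_domination_number :: "('a, 'b) pre_digraph \<Rightarrow> nat" where
  "strong_domination_number G = (LEAST k. \<exists>D. strong_dominating_set G D \<and> card D = k)"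

definition delete_verts :: "('a, 'b) pre_digraph \<Rightarrow> 'a set \<Rightarrow> ('a, 'b) pre_digraph" where
  "delete_verts G S = G \<restriction> (verts G - S)"

text \<open>
  Deleting all vertices is allowed; the null graph has strong domination number 0.
  Hence the minimum below is over a nonempty set for every finite graph with a vertex.
\<close>

definition strong_domination_stability :: "('a, 'b) pre_digraph \<Rightarrow> nat" where
  "strong_domination_stability G =
     (LEAST k. \<exists>S. S \<subseteq> verts G \<and>
        strong_domination_number (delete_verts G S) \<noteq> strong_domination_number G \<and>
        card S = k)"

text \<open>The vertex sets are made disjoint by passing to the sum type.\<close>

definition graph_join ::
    "'a pair_pre_digraph \<Rightarrow> 'b pair_pre_digraph \<Rightarrow> ('a + 'b) pair_pre_digraph" where
  "graph_join G H =
     \<lparr> pverts = pverts G <+> pverts H,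
       parcs = {(Inl u, Inl v) | u v. (u, v) \<in> parcs G}
             \<union> {(Inr u, Inr v) | u v. (u, v) \<in> parcs H}
             \<union> {(Inl u, Inr v) | u v. u \<in> pverts G \<and> v \<in> pverts H}
             \<union> {(Inr v, Inl u) | u v. u \<in> pverts G \<and> v \<in> pverts H} \<rparr>"

definition single_vertex_graph :: "unit pair_pre_digraph" where
  "single_vertex_graph = \<lparr> pverts = {()}, parcs = {} \<rparr>"

text \<open>The cycle on \<open>m\<close> vertices; meaningful only for \<open>m \<ge> 3\<close>.\<close>

definition cycle_graph :: "nat \<Rightarrow> nat pair_pre_digraph" where
  "cycle_graph m =
     \<lparr> pverts = {..<m},
       parcs = {(i, j). i < m \<and> j < m \<and> (j = Suc i mod m \<or> i = Suc j mod m)} \<rparr>"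

definition wheel_graph :: "nat \<Rightarrow> (unit + nat) pair_pre_digraph" where
  "wheel_graph n = graph_join single_vertex_graph (cycle_graph (n - 1))"

lemma complete_single_vertex_graph: "K\<^bsub>1\<^esub> (with_proj single_vertex_graph)"
  unfolding complete_digraph_pair_def by (simp add: single_vertex_graph_def)

lemma pair_graph_cycle_graph:
  assumes "m \<ge> 3"
  shows "pair_graph (cycle_graph m)"
proof
  fix e assume e: "e \<in> parcs (cycle_graph m)"
  show "fst e \<in> pverts (cycle_graph m)" "snd e \<in> pverts (cycle_graph m)"
    using e by (auto simp: cycle_graph_def)
  have "Suc i mod m \<noteq> i" if "i < m" for i
    using that assms by (cases "Suc i = m") auto
  then show "fst e \<noteq> snd e"
    using e by (fastforce simp: cycle_graph_def)
next
  show "finite (pverts (cycle_graph m))"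
    by (simp add: cycle_graph_def)
  have "parcs (cycle_graph m) \<subseteq> {..<m} \<times> {..<m}"
    by (auto simp: cycle_graph_def)
  then show "finite (parcs (cycle_graph m))"
    by (rule finite_subset) simp
  show "symmetric (with_proj (cycle_graph m))"
    by (auto simp: symmetric_def sym_def cycle_graph_def)
qed

lemma pair_graph_graph_join:
  assumes "pair_graph G" "pair_graph H"
  shows "pair_graph (graph_join G H)"
proof -
  interpret G: pair_graph G by fact
  interpret H: pair_graph H by fact
  have wf: "fst e \<in> pverts (graph_join G H) \<and> snd e \<in> pverts (graph_join G H)"
    if "e \<in> parcs (graph_join G H)" for e
    using that by (auto simp: graph_join_def dest: G.wellformed' H.wellformed')
  have fin: "finite (pverts (graph_join G H))"
    by (simp add: graph_join_def G.pair_finite_verts H.pair_finite_verts)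
  show ?thesis
  proof
    show "finite (parcs (graph_join G H))"
      by (rule finite_subset[of _ "pverts (graph_join G H) \<times> pverts (graph_join G H)"])
        (use wf fin in \<open>auto simp: mem_Times_iff\<close>)
    show "symmetric (with_proj (graph_join G H))"
      using G.pair_sym_arcs H.pair_sym_arcs
      by (auto simp: symmetric_def sym_def graph_join_def)
    show "fst e \<noteq> snd e" if "e \<in> parcs (graph_join G H)" for e
      using that by (auto simp: graph_join_def dest: G.pair_no_loops H.pair_no_loops)
  qed (use wf fin in auto)
qed

lemma pair_graph_wheel_graph:
  assumes "n \<ge> 4"
  shows "pair_graph (wheel_graph n)"
  unfolding wheel_graph_def
proof (rule pair_graph_graph_join)
  show "pair_graph single_vertex_graph"
    using complete_single_vertex_graph by (rule pair_graphI_complete)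
  show "pair_graph (cycle_graph (n - 1))"
    using assms by (intro pair_graph_cycle_graph) simp
qed

lemma card_verts_wheel_graph: "n \<ge> 1 \<Longrightarrow> card (pverts (wheel_graph n)) = n"
  by (simp add: wheel_graph_def graph_join_def single_vertex_graph_def cycle_graph_def card_Plus)

end

theory Submission
  imports Defs
begin

text \<open>
  The hub of the wheel is adjacent to all other vertices, so it alone is a strong
  dominating set. Deleting it leaves a cycle on at least 4 vertices, where no vertex is
  adjacent to all the others, so the strong domination number changes.
\<close>

context graph
begin

text \<open>Without parallel arcs \<open>head G\<close> is injective on the arcs leaving
  \<open>v\<close>, and without loops its image misses \<open>v\<close>.\<close>

lemma out_degree_le_card_verts:
  assumes "v \<in> verts G"
  shows "out_degree G v \<le> card (verts G - {v})"
  unfolding out_degree_def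
proof (rule card_inj_on_le[where f = "head G"])
  show "inj_on (head G) (out_arcs G v)"
    using no_multi_arcs by (auto simp: inj_on_def arc_to_ends_def)
  show "head G ` out_arcs G v \<subseteq> verts G - {v}"
    using no_loops by auto
qed simp

lemma out_degree_universal:
  assumes "u \<in> verts G" and "\<And>v. v \<in> verts G - {u} \<Longrightarrow> u \<rightarrow>\<^bsub>G\<^esub> v"
  shows "out_degree G u = card (verts G - {u})"
proof (rule antisym)
  have "verts G - {u} \<subseteq> head G ` out_arcs G u"
    using assms(2) by (fastforce simp: arcs_ends_conv)
  then show "card (verts G - {u}) \<le> out_degree G u"
    unfolding out_degree_def by (rule surj_card_le[rotated]) (simp add: out_arcs_def)
qed (rule out_degree_le_card_verts[OF assms(1)])

text \<open>A universal vertex attains the largest degree possible in the graph, so the degree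
  condition holds for \<open>{u}\<close> automatically.\<close>

lemma strong_domination_number_le_1:
  assumes u: "u \<in> verts G" and adj: "\<And>v. v \<in> verts G - {u} \<Longrightarrow> u \<rightarrow>\<^bsub>G\<^esub> v"
  shows "strong_domination_number G \<le> 1"
proof -
  have "out_degree G v \<le> out_degree G u" if "v \<in> verts G" for v
    using out_degree_le_card_verts[OF that] out_degree_universal[OF assms] u that
    by (simp add: card_Diff_singleton)
  then have "strong_dominating_set G {u}"
    using u adj by (auto simp: strong_dominating_set_def intro: graph_symmetric)
  then show ?thesis
    unfolding strong_domination_number_def by (intro Least_le exI[of _ "{u}"]) simp
qed

end

text \<open>The empty set dominates only the null graph, and a dominating singleton
  \<open>{u}\<close> would make every other vertex adjacent to \<open>u\<close>.\<close>

lemma strong_domination_number_ge_2: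
  assumes "finite (verts G)" and "verts G \<noteq> {}"
    and nonadj: "\<And>u. u \<in> verts G \<Longrightarrow> \<exists>v \<in> verts G - {u}. \<not> v \<rightarrow>\<^bsub>G\<^esub> u"
  shows "strong_domination_number G \<ge> 2"
proof -
  \<comment> \<open>This witness makes the \<open>LEAST\<close> range over a nonempty set, so the
    minimum is attained by some \<open>D\<close>.\<close>
  have "strong_dominating_set G (verts G)"
    by (simp add: strong_dominating_set_def)
  then have "\<exists>k D. strong_dominating_set G D \<and> card D = k"
    by blast
  from LeastI_ex[OF this] obtain D
    where D: "strong_dominating_set G D" and card: "card D = strong_domination_number G"
    unfolding strong_domination_number_def by blast
  \<comment> \<open>Infinite sets also have \<open>card\<close> 0; finiteness lets
    \<open>card D = 0\<close> force \<open>D = {}\<close>.\<close>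
  have "finite D"
    using D assms(1) finite_subset by (auto simp: strong_dominating_set_def)
  have False if "card D < 2"
  proof -
    from that consider "card D = 0" | "card D = 1" by linarith
    then show False
    proof cases
      case 1
      then show False
        using D \<open>finite D\<close> assms(2) by (auto simp: strong_dominating_set_def)
    next
      case 2
      then obtain u where "D = {u}" by (rule card_1_singletonE)
      then show False
        using D nonadj[of u] by (auto simp: strong_dominating_set_def)
    qed
  qed
  then show ?thesis
    using card by force
qed

text \<open>Well-formedness puts both ends of every arc in \<open>verts G\<close>, so the
  restriction loses no arc. This rules out stability 0.\<close>

lemma (in wf_digraph) delete_verts_empty: "delete_verts G {} = G"
  by (cases G) (use wellformed in \<open>auto simp: delete_verts_def induce_subgraph_def\<close>)

lemma cycle_graph_nonadjacent:
  assumes "m \<ge> 4" "i < m"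
  shows "\<exists>j < m. j \<noteq> i \<and> (j, i) \<notin> parcs (cycle_graph m)"
proof (intro exI conjI)
  \<comment> \<open>The vertex two steps after \<open>i\<close>, reduced modulo \<open>m\<close>. It
    differs from \<open>i\<close> and its successor, and \<open>m \<ge> 4\<close> separates it from
    the predecessor of \<open>i\<close>.\<close>
  let ?j = "if i + 2 < m then i + 2 else i + 2 - m"
  show "?j < m" "?j \<noteq> i" "(?j, i) \<notin> parcs (cycle_graph m)"
    using assms by (auto simp: cycle_graph_def mod_Suc)
qed

lemma wheel_graph_hub_adjacent:
  assumes "v \<in> pverts (wheel_graph n) - {Inl ()}"
  shows "(Inl (), v) \<in> parcs (wheel_graph n)"
  using assms by (auto simp: wheel_graph_def graph_join_def single_vertex_graph_def)

theorem proposition2p4: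
  fixes n :: nat
  assumes "n \<ge> 5"
  shows "strong_domination_stability (with_proj (wheel_graph n)) = 1"
proof -
  let ?W = "with_proj (wheel_graph n)"
  let ?C = "delete_verts ?W {Inl ()}"
  interpret pair_graph "wheel_graph n"
    using assms by (intro pair_graph_wheel_graph) simp
  have hub: "Inl () \<in> verts ?W"
    by (auto simp: wheel_graph_def graph_join_def single_vertex_graph_def)
  have "strong_domination_number ?W \<le> 1"
    using hub wheel_graph_hub_adjacent
    by (intro strong_domination_number_le_1[of "Inl ()"]) auto
  moreover have "strong_domination_number ?C \<ge> 2"
  proof (rule strong_domination_number_ge_2)
    have verts: "verts ?C = Inr ` {..<n - 1}"
      by (auto simp: delete_verts_def wheel_graph_def graph_join_def
          single_vertex_graph_def cycle_graph_def)
    then show "finite (verts ?C)" and "verts ?C \<noteq> {}"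
      using assms by (auto simp: lessThan_empty_iff)
    fix u assume "u \<in> verts ?C"
    then obtain i where i: "i < n - 1" "u = Inr i"
      using verts by auto
    \<comment> \<open>The bound on \<open>n\<close> enters here: for \<open>n = 4\<close> the rim
      would be a triangle, whose vertices are pairwise adjacent.\<close>
    have "n - 1 \<ge> 4"
      using assms by simp
    from cycle_graph_nonadjacent[OF this i(1)]
    obtain j where j: "j < n - 1" "j \<noteq> i" "(j, i) \<notin> parcs (cycle_graph (n - 1))"
      by blast
    \<comment> \<open>In the join, arcs between two \<open>Inr\<close> vertices come only from the
      cycle.\<close>
    have "\<not> Inr j \<rightarrow>\<^bsub>?C\<^esub> Inr i"
      using j by (auto simp: delete_verts_def arcs_ends_conv wheel_graph_def graph_join_def)
    then show "\<exists>v \<in> verts ?C - {u}. \<not> v \<rightarrow>\<^bsub>?C\<^esub> u"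
      using i j verts by auto
  qed
  ultimately have ne: "strong_domination_number ?C \<noteq> strong_domination_number ?W"
    by linarith
  show ?thesis
    unfolding strong_domination_stability_def
  proof (rule Least_equality)
    show "\<exists>S \<subseteq> verts ?W. strong_domination_number (delete_verts ?W S)
        \<noteq> strong_domination_number ?W \<and> card S = 1"
      using hub ne by (intro exI[of _ "{Inl ()}"]) simp
  next
    fix k
    assume "\<exists>S \<subseteq> verts ?W. strong_domination_number (delete_verts ?W S)
        \<noteq> strong_domination_number ?W \<and> card S = k"
    then obtain S where S: "S \<subseteq> verts ?W" "card S = k"
      "strong_domination_number (delete_verts ?W S) \<noteq> strong_domination_number ?W"
      by blast
    \<comment> \<open>Only the lower bound remains: a finite nonempty \<open>S\<close> has positive
      cardinality, and \<open>S\<close> is nonempty because deleting nothing leaves the number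
      unchanged.\<close>
    have "finite S"
      using S(1) by (rule finite_subset) simp
    moreover have "S \<noteq> {}"
      using S(3) delete_verts_empty by auto
    ultimately show "1 \<le> k"
      using S(2) by (auto simp: Suc_le_eq card_gt_0_iff)
  qed
qed

end
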